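(* Let $2\le n<\omega$. Then there is no cyclically dense element in $\operatorname{Aut}(\mathcal B_n)$; consequently, for every $m\ge1$ there is no cyclically dense $\bar g\in\operatorname{Aut}(\mathcal B_n)^m$ for the diagonal action of $\operatorname{Aut}(\mathcal B_n)$ on $\operatorname{Aut}(\mathcal B_n)^m$.
   Context: $\mathcal B_n$ is the poset with underlying set $\{1,\dots,n\}\times\mathbb Q$ and order $(k,p)\le(l,q)\iff k=l$ and $p\le q$. $\operatorname{Aut}(\mathcal B_n)$ carries the topology with basic open sets $\{\bar f: f\subset\bar f\}$, $f$ an isomorphism between finite subposets. For a topological group $G$, $\bar g=(g_1,\dots,g_m)\in G^m$ is cyclically dense for the diagonal action of $G$ on $G^m$ if for some $f\in G$ the set $\{(f^kg_1f^{-k},\dots,f^kg_mf^{-k}):k\in\mathbb Z\}$ is dense in $G^m$; an element $g\in G$ is cyclically dense if this holds with $m=1$. *)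

theory Defs
  imports "HOL-Algebra.Bij" "HOL-Analysis.Function_Topology"
begin

text \<open>A poset is given by its underlying set and its order; the order is only consulted on the
  underlying set.\<close>

definition poset_iso ::
  "'a set \<Rightarrow> ('a \<Rightarrow> 'a \<Rightarrow> bool) \<Rightarrow> 'b set \<Rightarrow> ('b \<Rightarrow> 'b \<Rightarrow> bool) \<Rightarrow> ('a \<Rightarrow> 'b) \<Rightarrow> bool" where
  "poset_iso A R B R' f \<longleftrightarrow>
     bij_betw f A B \<and> (\<forall>x\<in>A. \<forall>y\<in>A. R x y \<longleftrightarrow> R' (f x) (f y))"

text \<open>As in \<^const>\<open>BijGroup\<close>, automorphisms are extensional functions, so that each one is
  represented exactly once.\<close>

definition poset_Aut :: "'a set \<Rightarrow> ('a \<Rightarrow> 'a \<Rightarrow> bool) \<Rightarrow> ('a \<Rightarrow> 'a) set" where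
  "poset_Aut P R = {f \<in> Bij P. poset_iso P R P R f}"

definition poset_AutGroup :: "'a set \<Rightarrow> ('a \<Rightarrow> 'a \<Rightarrow> bool) \<Rightarrow> ('a \<Rightarrow> 'a) monoid" where
  "poset_AutGroup P R = (BijGroup P)\<lparr>carrier := poset_Aut P R\<rparr>"

text \<open>An isomorphism between finite subposets is a function \<open>f\<close> used only on its finite
  domain \<open>A\<close>; an automorphism extends it iff the two agree on \<open>A\<close>.\<close>

definition poset_Aut_basic_open ::
  "'a set \<Rightarrow> ('a \<Rightarrow> 'a \<Rightarrow> bool) \<Rightarrow> 'a set \<Rightarrow> ('a \<Rightarrow> 'a) \<Rightarrow> ('a \<Rightarrow> 'a) set" where
  "poset_Aut_basic_open P R A f = {h \<in> poset_Aut P R. \<forall>x\<in>A. h x = f x}"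

definition poset_Aut_topology :: "'a set \<Rightarrow> ('a \<Rightarrow> 'a \<Rightarrow> bool) \<Rightarrow> ('a \<Rightarrow> 'a) topology" where
  "poset_Aut_topology P R = topology_generated_by
     {poset_Aut_basic_open P R A f | A B f.
        finite A \<and> A \<subseteq> P \<and> finite B \<and> B \<subseteq> P \<and> poset_iso A R B R f}"

text \<open>For a topological group given by a group \<open>G\<close> and a topology \<open>T\<close> on its carrier; the power
  \<open>G\<^sup>m\<close> consists of the extensional functions on \<open>{1..m}\<close> with values in \<open>G\<close>.\<close>

definition cyclically_dense_tuple ::
  "('a, 'b) monoid_scheme \<Rightarrow> 'a topology \<Rightarrow> nat \<Rightarrow> (nat \<Rightarrow> 'a) \<Rightarrow> bool" where
  "cyclically_dense_tuple G T m g \<longleftrightarrow>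
     g \<in> (\<Pi>\<^sub>E i\<in>{1..m}. carrier G) \<and>
     (\<exists>f\<in>carrier G.
        (product_topology (\<lambda>_. T) {1..m}) closure_of
          {(\<lambda>i\<in>{1..m}. f [^]\<^bsub>G\<^esub> k \<otimes>\<^bsub>G\<^esub> g i \<otimes>\<^bsub>G\<^esub> f [^]\<^bsub>G\<^esub> (- k)) | k :: int. True}
        = topspace (product_topology (\<lambda>_. T) {1..m}))"

definition cyclically_dense_element ::
  "('a, 'b) monoid_scheme \<Rightarrow> 'a topology \<Rightarrow> 'a \<Rightarrow> bool" where
  "cyclically_dense_element G T g \<longleftrightarrow> cyclically_dense_tuple G T 1 (\<lambda>i\<in>{1..1}. g)"

definition B_set :: "nat \<Rightarrow> (nat \<times> rat) set" where
  "B_set n = {1..n} \<times> UNIV"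

definition B_le :: "nat \<times> rat \<Rightarrow> nat \<times> rat \<Rightarrow> bool" where
  "B_le x y \<longleftrightarrow> fst x = fst y \<and> snd x \<le> snd y"

definition B_AutGroup :: "nat \<Rightarrow> (nat \<times> rat \<Rightarrow> nat \<times> rat) monoid" where
  "B_AutGroup n = poset_AutGroup (B_set n) B_le"

definition B_Aut_topology :: "nat \<Rightarrow> (nat \<times> rat \<Rightarrow> nat \<times> rat) topology" where
  "B_Aut_topology n = poset_Aut_topology (B_set n) B_le"

lemma subgroup_poset_Aut: "subgroup (poset_Aut P R) (BijGroup P)"
proof (rule group.subgroupI[OF group_BijGroup])
  show "poset_Aut P R \<subseteq> carrier (BijGroup P)"
    by (auto simp: poset_Aut_def BijGroup_def)
  have "(\<lambda>x\<in>P. x) \<in> poset_Aut P R"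
    using id_Bij[of P] by (auto simp: poset_Aut_def poset_iso_def Bij_def)
  then show "poset_Aut P R \<noteq> {}" by auto
next
  fix f assume f: "f \<in> poset_Aut P R"
  then have fB: "f \<in> Bij P" and bij: "bij_betw f P P"
    and R: "\<And>x y. x \<in> P \<Longrightarrow> y \<in> P \<Longrightarrow> R x y = R (f x) (f y)"
    by (auto simp: poset_Aut_def poset_iso_def)
  let ?h = "\<lambda>x\<in>P. inv_into P f x"
  have h: "?h \<in> Bij P" using fB by (rule restrict_inv_into_Bij)
  have mem: "inv_into P f x \<in> P" and fh: "f (inv_into P f x) = x" if "x \<in> P" for x
    using bij that by (auto simp: bij_betw_def inv_into_into f_inv_into_f)
  have "poset_iso P R P R ?h"
    using h R[OF mem mem] fh by (simp add: poset_iso_def Bij_def)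
  then show "inv\<^bsub>BijGroup P\<^esub> f \<in> poset_Aut P R"
    using h fB by (simp add: inv_BijGroup poset_Aut_def)
next
  fix f g assume "f \<in> poset_Aut P R" "g \<in> poset_Aut P R"
  then show "f \<otimes>\<^bsub>BijGroup P\<^esub> g \<in> poset_Aut P R"
    using compose_Bij[of f P g] Bij_imp_funcset[of g P]
    by (auto simp: poset_Aut_def poset_iso_def BijGroup_def Bij_def compose_def Pi_iff)
qed

lemma group_poset_AutGroup: "group (poset_AutGroup P R)"
  unfolding poset_AutGroup_def
  by (rule group.subgroup_imp_group[OF group_BijGroup subgroup_poset_Aut])

lemma topspace_poset_Aut_topology:
  "topspace (poset_Aut_topology P R) = carrier (poset_AutGroup P R)"
proof -
  let ?S = "{poset_Aut_basic_open P R A f | A B f.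
        finite A \<and> A \<subseteq> P \<and> finite B \<and> B \<subseteq> P \<and> poset_iso A R B R f}"
  have "poset_iso {} R {} R id"
    by (simp add: poset_iso_def bij_betw_def)
  then have "poset_Aut_basic_open P R {} id \<in> ?S"
    by blast
  moreover have "poset_Aut_basic_open P R {} id = poset_Aut P R"
    by (simp add: poset_Aut_basic_open_def)
  ultimately have "\<Union>?S = poset_Aut P R"
    by (auto simp: poset_Aut_basic_open_def)
  then show ?thesis
    by (simp add: poset_Aut_topology_def topology_generated_by_topspace poset_AutGroup_def)
qed

end

theory Submission
  imports Defs "HOL-Combinatorics.Transposition"
begin

text \<open>
  The columns \<open>{i} \<times> \<rat>\<close> of \<open>\<B>\<^sub>n\<close> are the connected components of the order, so every
  automorphism permutes them and \<open>Aut(\<B>\<^sub>n)\<close> acts on the \<open>n\<close> columns. The kernel \<open>N\<close> of this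
  action is normal, hence each conjugacy class lies inside \<open>N\<close> or misses \<open>N\<close>. Both sides
  have interior: an automorphism fixing one point in each column lies in \<open>N\<close>
  (\<open>column_kernel_of_fixed_points\<close>), and one that sends \<open>(1,0)\<close> to \<open>(2,0)\<close> does not; for \<open>n \<ge> 2\<close>
  such a map exists, namely the exchange of two columns. So no conjugacy class is dense, let alone
  a cyclic part of one. A dense set of tuples has a dense first projection, which reduces every
  \<open>m \<ge> 1\<close> to this situation (\<open>no_cyclically_dense_tuple\<close>).
\<close>

text \<open>The preimages of \<open>U\<close> and \<open>V\<close> under the first projection are nonempty open sets of tuples, so a
  dense orbit meets both. This puts one conjugate of \<open>g 1\<close> inside \<open>N\<close> and another one outside,
  although conjugate elements belong to \<open>N\<close> together or not at all.\<close>

lemma no_cyclically_dense_tuple: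
  fixes G (structure)
  assumes "group G" and top: "topspace T = carrier G"
    and conj: "\<And>a h. a \<in> carrier G \<Longrightarrow> h \<in> N \<Longrightarrow> a \<otimes> h \<otimes> inv a \<in> N"
    and U: "openin T U" "U \<noteq> {}" "U \<subseteq> N"
    and V: "openin T V" "V \<noteq> {}" "V \<inter> N = {}"
    and m: "1 \<le> m"
  shows "\<not> cyclically_dense_tuple G T m g"
proof
  interpret group G by fact
  let ?T = "product_topology (\<lambda>_. T) {1..m}"
  assume "cyclically_dense_tuple G T m g"
  then obtain f S where g: "g \<in> (\<Pi>\<^sub>E i\<in>{1..m}. carrier G)" and f: "f \<in> carrier G"
    and S: "S = {(\<lambda>i\<in>{1..m}. f [^] k \<otimes> g i \<otimes> f [^] (- k)) | k :: int. True}"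
    and dense: "?T closure_of S = topspace ?T"
    unfolding cyclically_dense_tuple_def by blast
  have m1: "1 \<in> {1..m}" using m by simp
  have g1: "g 1 \<in> carrier G" using g m1 by blast
  have meets: "\<exists>k::int. f [^] k \<otimes> g 1 \<otimes> inv (f [^] k) \<in> W"
    if W: "openin T W" "W \<noteq> {}" for W
  proof -
    define box where "box = {x \<in> topspace ?T. x 1 \<in> W}"
    have op: "openin ?T box"
      unfolding box_def using continuous_map_product_projection[OF m1, of "\<lambda>_. T"] W(1)
      by (rule openin_continuous_map_preimage)
    obtain w where w: "w \<in> W" using W(2) by blast
    then have "w \<in> topspace T" using W(1) openin_subset by blast
    then have wbox: "(\<lambda>i\<in>{1..m}. w) \<in> box"
      using w m1 by (simp add: box_def topspace_product_topology)
    then have "(\<lambda>i\<in>{1..m}. w) \<in> ?T closure_of S"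
      unfolding dense by (simp add: box_def)
    then obtain y where y: "y \<in> S" "y \<in> box"
      using op wbox unfolding in_closure_of by blast
    from y(1) obtain k :: int
      where k: "y = (\<lambda>i\<in>{1..m}. f [^] k \<otimes> g i \<otimes> f [^] (- k))"
      unfolding S by blast
    have "y 1 \<in> W" using y(2) by (simp add: box_def)
    then have "f [^] k \<otimes> g 1 \<otimes> f [^] (- k) \<in> W" using m1 by (simp add: k)
    then have "f [^] k \<otimes> g 1 \<otimes> inv (f [^] k) \<in> W" by (simp add: int_pow_neg f)
    then show ?thesis by blast
  qed
  obtain k :: int where "f [^] k \<otimes> g 1 \<otimes> inv (f [^] k) \<in> U" using meets U by blast
  then have k: "f [^] k \<otimes> g 1 \<otimes> inv (f [^] k) \<in> N" using U by blast
  let ?a = "f [^] k"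
  have a: "?a \<in> carrier G" using f by simp
  have "inv ?a \<otimes> (?a \<otimes> g 1 \<otimes> inv ?a) \<otimes> inv (inv ?a) \<in> N" using conj[OF _ k] a by blast
  moreover have "inv ?a \<otimes> (?a \<otimes> g 1 \<otimes> inv ?a) \<otimes> inv (inv ?a) = g 1"
    using a g1 by (simp add: m_assoc) (simp add: m_assoc[symmetric])
  ultimately have gN: "g 1 \<in> N" by simp
  obtain l :: int where l: "f [^] l \<otimes> g 1 \<otimes> inv (f [^] l) \<in> V" using meets V by blast
  have "f [^] l \<otimes> g 1 \<otimes> inv (f [^] l) \<in> N" using conj[OF _ gN] f by simp
  then show False using l V(3) by blast
qed

text \<open>The kernel of the action of the automorphism group on the set of columns.\<close>

definition column_kernel :: "nat \<Rightarrow> (nat \<times> rat \<Rightarrow> nat \<times> rat) set" where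
  "column_kernel n = {h \<in> poset_Aut (B_set n) B_le. \<forall>x\<in>B_set n. fst (h x) = fst x}"

text \<open>Sharing a column amounts to comparability in the order, which an automorphism preserves.\<close>

lemma poset_Aut_same_column:
  assumes "h \<in> poset_Aut (B_set n) B_le" "x \<in> B_set n" "y \<in> B_set n" "fst x = fst y"
  shows "fst (h x) = fst (h y)"
proof -
  have "B_le x y \<or> B_le y x" using assms(4) by (auto simp: B_le_def)
  then have "B_le (h x) (h y) \<or> B_le (h y) (h x)"
    using assms(1-3) unfolding poset_Aut_def poset_iso_def by blast
  then show ?thesis by (auto simp: B_le_def)
qed

lemma column_kernel_of_fixed_points:
  assumes h: "h \<in> poset_Aut (B_set n) B_le"
    and fixed: "\<And>i. i \<in> {1..n} \<Longrightarrow> h (i, 0) = (i, 0)"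
  shows "h \<in> column_kernel n"
proof -
  have "fst (h x) = fst x" if x: "x \<in> B_set n" for x
    using poset_Aut_same_column[OF h x, of "(fst x, 0)"] fixed[of "fst x"] x
    by (auto simp: B_set_def)
  then show ?thesis using h by (simp add: column_kernel_def)
qed

lemma B_AutGroup_mult_apply:
  assumes "a \<in> carrier (B_AutGroup n)" "b \<in> carrier (B_AutGroup n)" "x \<in> B_set n"
  shows "(a \<otimes>\<^bsub>B_AutGroup n\<^esub> b) x = a (b x)"
  using assms
  by (simp add: B_AutGroup_def poset_AutGroup_def BijGroup_def poset_Aut_def compose_def)

lemma column_kernel_conj:
  fixes n defines "G \<equiv> B_AutGroup n"
  assumes a: "a \<in> carrier G" and h: "h \<in> column_kernel n"
  shows "a \<otimes>\<^bsub>G\<^esub> h \<otimes>\<^bsub>G\<^esub> inv\<^bsub>G\<^esub> a \<in> column_kernel n"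
proof -
  interpret group G unfolding G_def B_AutGroup_def by (rule group_poset_AutGroup)
  have carr: "carrier G = poset_Aut (B_set n) B_le"
    by (simp add: G_def B_AutGroup_def poset_AutGroup_def)
  note app = B_AutGroup_mult_apply[of _ n, folded G_def]
  have hc: "h \<in> carrier G" using h by (simp add: carr column_kernel_def)
  have ic: "inv\<^bsub>G\<^esub> a \<in> carrier G" using a by simp
  have mem: "b x \<in> B_set n" if "b \<in> carrier G" "x \<in> B_set n" for b x
    using that by (auto simp: carr poset_Aut_def poset_iso_def bij_betw_def)
  have "fst ((a \<otimes>\<^bsub>G\<^esub> h \<otimes>\<^bsub>G\<^esub> inv\<^bsub>G\<^esub> a) y) = fst y" if y: "y \<in> B_set n" for y
  proof -
    let ?z = "(inv\<^bsub>G\<^esub> a) y"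
    have z: "?z \<in> B_set n" using mem ic y by blast
    have "a ?z = (a \<otimes>\<^bsub>G\<^esub> inv\<^bsub>G\<^esub> a) y" using app[OF a ic y] by simp
    also have "\<dots> = y"
      using r_inv[OF a] y by (simp add: G_def B_AutGroup_def poset_AutGroup_def BijGroup_def)
    finally have az: "a ?z = y" .
    have "fst (h ?z) = fst ?z" using h z by (simp add: column_kernel_def)
    then have "fst (a (h ?z)) = fst (a ?z)"
      by (rule poset_Aut_same_column[OF a[unfolded carr] mem[OF hc z] z])
    then show ?thesis using az app a hc ic y z by simp
  qed
  moreover have "a \<otimes>\<^bsub>G\<^esub> h \<otimes>\<^bsub>G\<^esub> inv\<^bsub>G\<^esub> a \<in> poset_Aut (B_set n) B_le"
    using a hc ic by (simp flip: carr)
  ultimately show ?thesis by (simp add: column_kernel_def)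
qed

lemma column_permutation_in_Aut:
  assumes "bij_betw p {1..n} {1..n}"
  shows "(\<lambda>x\<in>B_set n. (p (fst x), snd x)) \<in> poset_Aut (B_set n) B_le"
proof -
  have "bij_betw (map_prod p id) (B_set n) (B_set n)"
    unfolding B_set_def using assms by (intro bij_betw_map_prod) auto
  moreover have "bij_betw (map_prod p id) (B_set n) (B_set n) \<longleftrightarrow>
      bij_betw (\<lambda>x\<in>B_set n. (p (fst x), snd x)) (B_set n) (B_set n)"
    by (rule bij_betw_cong) (auto simp: map_prod_def split: prod.splits)
  ultimately have bij: "bij_betw (\<lambda>x\<in>B_set n. (p (fst x), snd x)) (B_set n) (B_set n)" by blast
  have inj: "inj_on p {1..n}" using assms by (simp add: bij_betw_def)
  have "p (fst x) = p (fst y) \<longleftrightarrow> fst x = fst y" if "x \<in> B_set n" "y \<in> B_set n" for x y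
    using that inj by (auto simp: B_set_def inj_on_def)
  then show ?thesis using bij by (simp add: poset_Aut_def poset_iso_def Bij_def B_le_def)
qed

lemma openin_poset_Aut_topology_basic:
  assumes "finite A" "A \<subseteq> P" "finite B" "B \<subseteq> P" "poset_iso A R B R f"
  shows "openin (poset_Aut_topology P R) (poset_Aut_basic_open P R A f)"
  unfolding poset_Aut_topology_def
  by (rule topology_generated_by_Basis) (use assms in blast)

theorem mainTheorem6:
  fixes n :: nat
  assumes "2 \<le> n"
  shows "(\<nexists>g. cyclically_dense_element (B_AutGroup n) (B_Aut_topology n) g) \<and>
    (\<forall>m\<ge>1. \<nexists>g. cyclically_dense_tuple (B_AutGroup n) (B_Aut_topology n) m g)"
proof -
  let ?P = "B_set n"
  let ?U = "poset_Aut_basic_open ?P B_le ({1..n} \<times> {0}) (\<lambda>x. x)"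
  let ?V = "poset_Aut_basic_open ?P B_le {(1, 0)} (\<lambda>_. (2, 0))"
  have U: "openin (B_Aut_topology n) ?U"
    unfolding B_Aut_topology_def
    by (rule openin_poset_Aut_topology_basic[where B = "{1..n} \<times> {0}"])
      (auto simp: B_set_def poset_iso_def bij_betw_def)
  have V: "openin (B_Aut_topology n) ?V"
    unfolding B_Aut_topology_def
    by (rule openin_poset_Aut_topology_basic[where B = "{(2, 0)}"])
      (use assms in \<open>auto simp: B_set_def poset_iso_def bij_betw_def B_le_def\<close>)
  have "(\<lambda>x\<in>?P. (id (fst x), snd x)) \<in> ?U"
    using column_permutation_in_Aut[of id n] by (auto simp: poset_Aut_basic_open_def B_set_def)
  then have U0: "?U \<noteq> {}" by blast
  have "bij_betw (transpose 1 2) {1..n} {1..n}"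
    using assms by (intro bij_betwI[of _ _ _ "transpose 1 2"]) (auto simp: transpose_def)
  from column_permutation_in_Aut[OF this]
  have "(\<lambda>x\<in>?P. (transpose 1 2 (fst x), snd x)) \<in> ?V"
    using assms by (simp add: poset_Aut_basic_open_def B_set_def)
  then have V0: "?V \<noteq> {}" by blast
  have UN: "?U \<subseteq> column_kernel n"
    by (auto simp: poset_Aut_basic_open_def intro!: column_kernel_of_fixed_points)
  have VN: "?V \<inter> column_kernel n = {}"
  proof -
    have "(1, 0) \<in> ?P" using assms by (simp add: B_set_def)
    then have "h (1, 0) \<noteq> (2, 0)" if "h \<in> column_kernel n" for h
      using that by (force simp: column_kernel_def)
    then show ?thesis by (auto simp: poset_Aut_basic_open_def)
  qed
  have group: "group (B_AutGroup n)"
    unfolding B_AutGroup_def by (rule group_poset_AutGroup)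
  have top: "topspace (B_Aut_topology n) = carrier (B_AutGroup n)"
    unfolding B_Aut_topology_def B_AutGroup_def by (rule topspace_poset_Aut_topology)
  have "\<not> cyclically_dense_tuple (B_AutGroup n) (B_Aut_topology n) m g" if "1 \<le> m" for m g
    by (rule no_cyclically_dense_tuple[OF group top column_kernel_conj U U0 UN V V0 VN that])
  then show ?thesis unfolding cyclically_dense_element_def by simp
qed

end
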